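(* Let $X=\{X(t)\}_{t\ge 0}$ be the generalized fractional Brownian motion with parameters $\gamma\in[0,1)$ and $\alpha\in\big(-\tfrac12+\tfrac{\gamma}{2},\,\tfrac12+\tfrac{\gamma}{2}\big)$, let $H=\alpha-\tfrac{\gamma}{2}+\tfrac12\in(0,1)$, and let $\Phi(s,t)=E[(X(s)-X(t))^2]$. Then for every $T>0$ there exists a positive constant $C_T$ such that $$\Phi(s,t)\le C_T\,|s-t|^{2H}\qquad\text{for all } 0<s<t\le T,$$ and hence, for every $\alpha_0$ with $0<\alpha_0<H=(2\alpha-\gamma+1)/2$, the sample path $t\mapsto X(t)$, $0\le t\le T$, is almost surely $\alpha_0$-Hölder continuous.
   Context: Let $B(\mathrm{d}u)$ be a Gaussian random measure on $\mathbb{R}$ with Lebesgue control measure $\mathrm{d}u$ (equivalently, the white noise of a two-sided standard Brownian motion $B$). For $\gamma\in[0,1)$ and $\alpha\in(-\frac12+\frac{\gamma}{2},\frac12+\frac{\gamma}{2})$, the generalized fractional Brownian motion (GFBM) is the mean-zero Gaussian process with continuous sample paths given (in distribution, as a process) by $$X(t)= c\int_{\mathbb{R}}\big((t-u)_+^{\alpha}-(-u)_+^{\alpha}\big)\,|u|^{-\gamma/2}\,B(\mathrm{d}u),\qquad t\ge 0,$$ where $x_+^{\alpha}=x^{\alpha}$ if $x>0$ and $x_+^{\alpha}=0$ otherwise, and $c=c(\alpha,\gamma)>0$ is the normalization constant for which $\mathrm{Var}(X(t))=t^{2H}$ for all $t\ge0$, that is, $c^{-2}=\int_0^1(1-v)^{2\alpha}v^{-\gamma}\,\mathrm{d}v+\int_0^\infty[(1+v)^{\alpha}-v^{\alpha}]^2v^{-\gamma}\,\mathrm{d}v$.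 Here $X(0)=0$ and $X$ is self-similar with Hurst parameter $H=\alpha-\frac{\gamma}{2}+\frac12\in(0,1)$. The second moment function of the increments is $$\Phi(s,t)=E[(X(s)-X(t))^2]=c^2\int_{\mathbb{R}}\big((t-u)_+^{\alpha}-(s-u)_+^{\alpha}\big)^2|u|^{-\gamma}\,\mathrm{d}u .$$ *)

theory Defs
  imports "HOL-Probability.Probability"
begin

text \<open>Degenerate (almost surely zero) variables count as Gaussian, with \<open>\<sigma> = 0\<close>; that case is
  separate because \<open>normal_density 0 0\<close> is not a probability density.\<close>

definition centered_gaussian :: "'a measure \<Rightarrow> ('a \<Rightarrow> real) \<Rightarrow> bool" where
  "centered_gaussian M Y \<longleftrightarrow> Y \<in> borel_measurable M \<and>
     (\<exists>\<sigma>\<ge>0. distr M borel Y =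
        (if \<sigma> = 0 then return borel 0
         else density lborel (\<lambda>x. ennreal (normal_density 0 \<sigma> x))))"

definition centered_gaussian_process ::
  "'a measure \<Rightarrow> 'i set \<Rightarrow> ('i \<Rightarrow> 'a \<Rightarrow> real) \<Rightarrow> bool" where
  "centered_gaussian_process M I X \<longleftrightarrow>
     (\<forall>J a. finite J \<and> J \<subseteq> I \<longrightarrow> centered_gaussian M (\<lambda>\<omega>. \<Sum>i\<in>J. a i * X i \<omega>))"

definition finite_measure_sets :: "'c measure \<Rightarrow> 'c set set" where
  "finite_measure_sets \<mu> = {A \<in> sets \<mu>. emeasure \<mu> A < \<infinity>}"

definition gaussian_random_measure ::
  "'b measure \<Rightarrow> 'c measure \<Rightarrow> ('c set \<Rightarrow> 'b \<Rightarrow> real) \<Rightarrow> bool" where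
  "gaussian_random_measure N \<mu> B \<longleftrightarrow> prob_space N \<and>
     centered_gaussian_process N (finite_measure_sets \<mu>) B \<and>
     (\<forall>A\<in>finite_measure_sets \<mu>. \<forall>A'\<in>finite_measure_sets \<mu>.
        integral\<^sup>L N (\<lambda>\<omega>. B A \<omega> * B A' \<omega>) = measure \<mu> (A \<inter> A'))"

text \<open>\<open>Y\<close> is (a version of) the Wiener integral \<open>\<integral> f dB\<close>: there are simple functions
  \<open>\<Sum>i<n k. a k i * 1\<^sub>A\<^sub>k\<^sub>i\<close> converging to \<open>f\<close> in \<open>L\<^sup>2(\<mu>)\<close> whose integrals
  \<open>\<Sum>i<n k. a k i * B (A k i)\<close> converge to \<open>Y\<close> in \<open>L\<^sup>2(N)\<close>. The integral is determined only up
  to null sets and only for square integrable \<open>f\<close>, hence a relation.\<close>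

definition is_wiener_integral ::
  "'b measure \<Rightarrow> 'c measure \<Rightarrow> ('c set \<Rightarrow> 'b \<Rightarrow> real) \<Rightarrow> ('c \<Rightarrow> real) \<Rightarrow> ('b \<Rightarrow> real) \<Rightarrow> bool" where
  "is_wiener_integral N \<mu> B f Y \<longleftrightarrow>
     f \<in> borel_measurable \<mu> \<and> Y \<in> borel_measurable N \<and>
     (\<exists>(n :: nat \<Rightarrow> nat) (a :: nat \<Rightarrow> nat \<Rightarrow> real) (A :: nat \<Rightarrow> nat \<Rightarrow> 'c set).
        (\<forall>k. \<forall>i<n k. A k i \<in> finite_measure_sets \<mu>) \<and>
        ((\<lambda>k. \<integral>\<^sup>+u. ennreal (((\<Sum>i<n k. a k i * indicator (A k i) u) - f u)\<^sup>2) \<partial>\<mu>)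
           \<longlonglongrightarrow> 0) \<and>
        ((\<lambda>k. \<integral>\<^sup>+\<omega>. ennreal (((\<Sum>i<n k. a k i * B (A k i) \<omega>) - Y \<omega>)\<^sup>2) \<partial>N)
           \<longlonglongrightarrow> 0))"

definition pos_powr :: "real \<Rightarrow> real \<Rightarrow> real" where
  "pos_powr x \<alpha> = (if x > 0 then x powr \<alpha> else 0)"

definition gfbm_kernel :: "real \<Rightarrow> real \<Rightarrow> real \<Rightarrow> real \<Rightarrow> real" where
  "gfbm_kernel \<alpha> \<gamma> t u = (pos_powr (t - u) \<alpha> - pos_powr (- u) \<alpha>) * \<bar>u\<bar> powr (- \<gamma> / 2)"

definition gfbm_const :: "real \<Rightarrow> real \<Rightarrow> real" where
  "gfbm_const \<alpha> \<gamma> = 1 / sqrt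
     ((LINT v:{0<..<1}|lborel. (1 - v) powr (2 * \<alpha>) * v powr (- \<gamma>)) +
      (LINT v:{0<..}|lborel. ((1 + v) powr \<alpha> - v powr \<alpha>)\<^sup>2 * v powr (- \<gamma>)))"

definition same_process_law ::
  "'i set \<Rightarrow> 'a measure \<Rightarrow> ('i \<Rightarrow> 'a \<Rightarrow> real) \<Rightarrow> 'b measure \<Rightarrow> ('i \<Rightarrow> 'b \<Rightarrow> real) \<Rightarrow> bool" where
  "same_process_law I M X N Y \<longleftrightarrow>
     distr M (Pi\<^sub>M I (\<lambda>_. borel)) (\<lambda>\<omega>. \<lambda>t\<in>I. X t \<omega>) =
     distr N (Pi\<^sub>M I (\<lambda>_. borel)) (\<lambda>\<omega>. \<lambda>t\<in>I. Y t \<omega>)"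

text \<open>\<open>X\<close> lives on \<open>M\<close> and has the law of the stochastic integral process built from the noise
  \<open>B\<close>, which may live on a different probability space \<open>N\<close>.\<close>

definition is_gfbm ::
  "real \<Rightarrow> real \<Rightarrow> 'b measure \<Rightarrow> (real set \<Rightarrow> 'b \<Rightarrow> real) \<Rightarrow>
   'a measure \<Rightarrow> (real \<Rightarrow> 'a \<Rightarrow> real) \<Rightarrow> bool" where
  "is_gfbm \<alpha> \<gamma> N B M X \<longleftrightarrow> prob_space M \<and>
     centered_gaussian_process M {0..} X \<and>
     (AE \<omega> in M. continuous_on {0..} (\<lambda>t. X t \<omega>)) \<and>
     (\<exists>I. (\<forall>t\<ge>0. is_wiener_integral N lborel B (gfbm_kernel \<alpha> \<gamma> t) (I t)) \<and>
          same_process_law {0..} M X N (\<lambda>t \<omega>. gfbm_const \<alpha> \<gamma> * I t \<omega>))"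

definition incr_second_moment :: "'a measure \<Rightarrow> (real \<Rightarrow> 'a \<Rightarrow> real) \<Rightarrow> real \<Rightarrow> real \<Rightarrow> real" where
  "incr_second_moment M X s t = integral\<^sup>L M (\<lambda>\<omega>. (X s \<omega> - X t \<omega>)\<^sup>2)"

definition holder_on :: "real \<Rightarrow> real set \<Rightarrow> (real \<Rightarrow> real) \<Rightarrow> bool" where
  "holder_on \<beta> S f \<longleftrightarrow> (\<exists>K. \<forall>s\<in>S. \<forall>t\<in>S. \<bar>f s - f t\<bar> \<le> K * \<bar>s - t\<bar> powr \<beta>)"

end

theory Submission
  imports Defs
begin

text \<open>
  By the Wiener isometry, \<open>\<Phi>(s,t)\<close> is at most a constant times \<open>\<integral> (k\<^sub>t - k\<^sub>s)\<^sup>2\<close>, where \<open>k\<close> is the kernel.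
  With \<open>h = t - s\<close> and \<open>u = s - h w\<close> this integral becomes
  \<open>h\<close> to the power \<open>2H\<close> times \<open>\<integral> ((1+w)\<^sub>+\<^sup>\<alpha> - w\<^sub>+\<^sup>\<alpha>)\<^sup>2 \<bar>s/h - w\<bar>\<^sup>-\<^sup>\<gamma> dw\<close>. The squared increment is dominated by
  decreasing powers of \<open>1 + w\<close> or \<open>w\<close>, and a product of negative powers of \<open>x\<close> and \<open>y\<close> is at most the
  combined power of the smaller one, so this integral is bounded uniformly in \<open>s/h\<close>.

  For the paths, Gaussianity turns the variance bound into moment bounds of every even order \<open>2m\<close>.
  If \<open>2m(H - \<beta>) > 1\<close>, the sum over all dyadic increments of their \<open>2m\<close>-th powers, weighted by
  \<open>2\<close> to the power \<open>2mn\<beta>\<close> at level \<open>n\<close>, has finite expectation, hence is almost surely finite. It bounds all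
  dyadic increments at once, and chaining along the dyadic approximations of a point gives the
  Hoelder condition for continuous paths.
\<close>

subsection \<open>Hoelder continuity from dyadic increments\<close>

text \<open>Chaining: \<open>x\<close> is reached from its level-\<open>n\<close> grid point through
  finer grid points, each refinement costing at most one dyadic increment, so the total error is a
  geometric tail. Two points are compared at the level whose mesh matches their distance.\<close>

lemma holder_on_dyadic_increments:
  fixes f :: "real \<Rightarrow> real"
  assumes \<beta>: "0 < \<beta>" and K: "0 \<le> K" and cont: "continuous_on {0..1} f"
    and incr: "\<And>n i. i < 2 ^ n \<Longrightarrow>
      \<bar>f (real (Suc i) / 2 ^ n) - f (real i / 2 ^ n)\<bar> \<le> K * (2 powr - \<beta>) ^ n"
  shows "holder_on \<beta> {0..1} f"
proof -
  define r where "r = 2 powr - \<beta>"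
  have r: "0 < r" "r < 1"
    unfolding r_def using \<beta> powr_less_mono[of "-\<beta>" 0 2] by auto
  \<comment> \<open>\<open>p n x\<close> is the last grid point of mesh \<open>1 / 2 ^ n\<close> at
    or below \<open>x\<close>, and \<open>m n x\<close> is its index.\<close>
  define m where "m n x = nat \<lfloor>2 ^ n * x\<rfloor>" for n :: nat and x :: real
  define p where "p n x = real (m n x) / 2 ^ n" for n :: nat and x :: real
  \<comment> \<open>\<open>L * r ^ n\<close> is \<open>K\<close> times the geometric tail of
    \<open>r\<close> from exponent \<open>n + 1\<close> on.\<close>
  define L where "L = K * r / (1 - r)"
  have L: "0 \<le> L" using r K by (simp add: L_def)
  have m_bounds: "real (m n x) \<le> 2 ^ n * x" "2 ^ n * x < real (m n x) + 1" if "0 \<le> x" for n x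
    using that by (auto simp: m_def)
  have p_mem: "p n x \<in> {0..1}" and p_close: "\<bar>p n x - x\<bar> \<le> (1/2) ^ n" if "x \<in> {0..1}" for n x
  proof -
    have "p n x \<le> x" "x \<le> p n x + (1/2) ^ n"
      using m_bounds[of x n] that by (auto simp: p_def field_simps power_one_over)
    moreover have "0 \<le> p n x" by (simp add: p_def)
    ultimately show "p n x \<in> {0..1}" "\<bar>p n x - x\<bar> \<le> (1/2) ^ n" using that by auto
  qed
  have incr': "\<bar>f (real (Suc i) / 2 ^ n) - f (real i / 2 ^ n)\<bar> \<le> K * r ^ n" if "Suc i \<le> 2 ^ n" for n i
    using incr[of i n] that by (simp add: r_def)
  \<comment> \<open>The index \<open>2 ^ n\<close> occurs at \<open>x = 1\<close>. This bound keeps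
    the right end of every increment used below inside the unit interval.\<close>
  have m_le: "m n x \<le> 2 ^ n" if "x \<in> {0..1}" for n x
  proof -
    have "2 ^ n * x \<le> 2 ^ n" using that by (simp add: mult_left_le)
    then have "real (m n x) \<le> 2 ^ n" using order_trans[OF m_bounds(1)[of x n], of "2 ^ n"] that by simp
    then show ?thesis by (metis of_nat_le_iff of_nat_numeral of_nat_power)
  qed
  have step: "\<bar>f (p (Suc n) x) - f (p n x)\<bar> \<le> K * r ^ Suc n" if "x \<in> {0..1}" for n x
  proof -
    \<comment> \<open>The floor of \<open>2y\<close> is twice the floor of \<open>y\<close>, or one
      more: refining the grid moves the point by zero or one step of the finer mesh.\<close>
    have "real (m (Suc n) x) < 2 * (real (m n x) + 1)" "2 * real (m n x) < real (m (Suc n) x) + 1"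
      using m_bounds[of x n] m_bounds[of x "Suc n"] that by auto
    then have "real (m (Suc n) x) < real (2 * m n x + 2)" "real (2 * m n x) < real (m (Suc n) x + 1)" by simp_all
    then have "m (Suc n) x = 2 * m n x \<or> m (Suc n) x = Suc (2 * m n x)"
      unfolding of_nat_less_iff by arith
    moreover have "p n x = real (2 * m n x) / 2 ^ Suc n" by (simp add: p_def)
    ultimately show ?thesis
      using incr'[of "2 * m n x" "Suc n"] m_le[OF that, of "Suc n"] K r
      unfolding p_def[of "Suc n"] by (elim disjE) auto
  qed
  \<comment> \<open>Writing the partial geometric sum as a difference of powers lets the induction
    close exactly.\<close>
  have tele: "\<bar>f (p (n + k) x) - f (p n x)\<bar> \<le> L * (r ^ n - r ^ (n + k))" if "x \<in> {0..1}" for n k x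
  proof (induction k)
    case (Suc k)
    have "L * (r ^ (n + k) - r ^ Suc (n + k)) = K * r ^ Suc (n + k)"
      using r by (simp add: L_def field_simps)
    then show ?case
      using Suc step[OF that, of "n + k"] by (simp add: right_diff_distrib)
  qed simp
  \<comment> \<open>Continuity carries the telescoped bound from the grid points to \<open>x\<close>
    itself.\<close>
  have approx: "\<bar>f x - f (p n x)\<bar> \<le> L * r ^ n" if x: "x \<in> {0..1}" for n x
  proof -
    have "(\<lambda>k. p (n + k) x - x) \<longlonglongrightarrow> 0"
    proof (rule Lim_null_comparison)
      have "(\<lambda>k. (1/2::real) ^ (k + n)) \<longlonglongrightarrow> 0"
        by (rule LIMSEQ_ignore_initial_segment) (simp add: LIMSEQ_power_zero)
      then show "(\<lambda>k. (1/2::real) ^ (n + k)) \<longlonglongrightarrow> 0" by (simp add: add.commute)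
    qed (use p_close[OF x] in auto)
    then have "(\<lambda>k. p (n + k) x) \<longlonglongrightarrow> x" by (simp add: LIM_zero_iff)
    then have "(\<lambda>k. f (p (n + k) x)) \<longlonglongrightarrow> f x"
      using p_mem[OF x] x by (intro continuous_on_tendsto_compose[OF cont]) auto
    then have "(\<lambda>k. \<bar>f (p (n + k) x) - f (p n x)\<bar>) \<longlonglongrightarrow> \<bar>f x - f (p n x)\<bar>"
      by (intro tendsto_intros)
    moreover have "\<bar>f (p (n + k) x) - f (p n x)\<bar> \<le> L * r ^ n" for k
    proof -
      have "L * (r ^ n - r ^ (n + k)) \<le> L * r ^ n" using L r by (intro mult_left_mono) auto
      then show ?thesis using tele[OF x, of n k] by linarith
    qed
    ultimately show ?thesis by (intro LIMSEQ_le_const2) auto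
  qed
  have *: "\<bar>f s - f t\<bar> \<le> (2 * L + K) * 2 powr \<beta> * \<bar>s - t\<bar> powr \<beta>"
    if st: "s \<in> {0..1}" "t \<in> {0..1}" "s < t" for s t
  proof -
    \<comment> \<open>This level satisfies \<open>1 / 2 ^ Suc n < t - s \<le> 1 / 2 ^ n\<close>. The
      upper bound makes the grid indices of \<open>s\<close> and \<open>t\<close> equal or
      consecutive; the lower one turns \<open>r ^ n\<close> into a power of
      \<open>t - s\<close>.\<close>
    define n where "n = nat \<lfloor>log 2 (1 / (t - s))\<rfloor>"
    have "0 \<le> log 2 (1 / (t - s))" using st by simp
    then have n: "real n \<le> log 2 (1 / (t - s))" "log 2 (1 / (t - s)) < real (Suc n)"
      unfolding n_def by (simp, simp, linarith)
    then have "2 ^ n \<le> 1 / (t - s)" "1 / (t - s) < 2 ^ Suc n"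
      using st by (auto simp: le_log_iff log_less_iff powr_realpow[symmetric] simp del: power_Suc)
    then have d: "2 ^ n * t \<le> 2 ^ n * s + 1" "1 < (t - s) * 2 ^ Suc n"
      using st by (auto simp: field_simps)
    have "2 ^ n * s \<le> 2 ^ n * t" "0 \<le> s" "0 \<le> t" using st by auto
    with d(1) have "real (m n s) < real (m n t) + 1" "real (m n t) < real (m n s) + 2"
      using m_bounds[of s n] m_bounds[of t n] by linarith+
    then have "real (m n s) < real (m n t + 1)" "real (m n t) < real (m n s + 2)" by simp_all
    then have "m n t = m n s \<or> m n t = Suc (m n s)" unfolding of_nat_less_iff by arith
    then have mid: "\<bar>f (p n t) - f (p n s)\<bar> \<le> K * r ^ n"
      using incr'[of "m n s" n] m_le[OF st(2), of n] K r unfolding p_def by (elim disjE) auto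
    have "\<bar>f s - f t\<bar> \<le> (2 * L + K) * r ^ n"
      using mid approx[OF st(1), of n] approx[OF st(2), of n] by (simp add: algebra_simps)
    \<comment> \<open>The factor \<open>2 powr \<beta>\<close> pays for the gap between
      \<open>2 ^ n\<close> and \<open>2 ^ Suc n\<close>.\<close>
    also have "r ^ n \<le> 2 powr \<beta> * \<bar>s - t\<bar> powr \<beta>"
    proof -
      have "1 \<le> ((t - s) * 2 ^ Suc n) powr \<beta>" using d \<beta> by (intro ge_one_powr_ge_zero) auto
      also have "\<dots> = (t - s) powr \<beta> * 2 powr (\<beta> * real (Suc n))"
        using st by (simp add: powr_mult powr_powr powr_realpow[symmetric] mult.commute del: power_Suc)
      finally have "1 \<le> (t - s) powr \<beta> * (2 powr \<beta> * 2 powr (\<beta> * real n))"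
        by (simp add: distrib_left powr_add)
      moreover have "r ^ n = 1 / 2 powr (\<beta> * real n)"
      proof -
        have "r ^ n = (2 powr - \<beta>) powr real n" using r by (simp add: r_def powr_realpow)
        also have "\<dots> = 2 powr - (\<beta> * real n)" unfolding powr_powr by simp
        finally show ?thesis by (simp only: powr_minus_divide)
      qed
      ultimately show ?thesis using st by (simp add: divide_le_eq mult_ac)
    qed
    then have "(2 * L + K) * r ^ n \<le> (2 * L + K) * (2 powr \<beta> * \<bar>s - t\<bar> powr \<beta>)"
      using L K by (intro mult_left_mono) auto
    finally show ?thesis by (simp add: mult_ac)
  qed
  show ?thesis
    unfolding holder_on_def
  proof (intro exI[of _ "(2 * L + K) * 2 powr \<beta>"] ballI)
    fix s t :: real assume "s \<in> {0..1}" "t \<in> {0..1}"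
    then show "\<bar>f s - f t\<bar> \<le> (2 * L + K) * 2 powr \<beta> * \<bar>s - t\<bar> powr \<beta>"
      using *[of s t] *[of t s] by (cases s t rule: linorder_cases) (auto simp: abs_minus_commute)
  qed
qed

subsection \<open>Gaussian variables and Wiener integrals\<close>

text \<open>The factor is the double factorial of \<open>2k - 1\<close>. Expressing the moment
  through the variance instead of \<open>\<sigma>\<close> lets one variance bound control every even
  moment; \<open>k = 1\<close> also supplies square integrability.\<close>

lemma centered_gaussian_even_moment:
  assumes "prob_space M" and "centered_gaussian M Y"
  shows "integrable M (\<lambda>\<omega>. Y \<omega> ^ (2 * k))"
    and "(LINT \<omega>|M. Y \<omega> ^ (2 * k)) = fact (2 * k) / (2 ^ k * fact k) * (LINT \<omega>|M. (Y \<omega>)\<^sup>2) ^ k"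
proof -
  from assms(2) obtain \<sigma> where [measurable]: "Y \<in> borel_measurable M" and "0 \<le> \<sigma>" and
    D: "distr M borel Y = (if \<sigma> = 0 then return borel 0
         else density lborel (\<lambda>x. ennreal (normal_density 0 \<sigma> x)))"
    by (auto simp: centered_gaussian_def)
  have I: "integrable M (\<lambda>\<omega>. Y \<omega> ^ (2 * k)) \<and>
    (LINT \<omega>|M. Y \<omega> ^ (2 * k)) = fact (2 * k) / (2 ^ k * fact k) * (\<sigma>\<^sup>2) ^ k" for k
  proof -
    have int: "integrable M (\<lambda>\<omega>. Y \<omega> ^ (2 * k)) \<longleftrightarrow> integrable (distr M borel Y) (\<lambda>x. x ^ (2 * k))"
      by (subst integrable_distr_eq) auto
    have val: "(LINT \<omega>|M. Y \<omega> ^ (2 * k)) = (LINT x|distr M borel Y. x ^ (2 * k))"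
      by (subst integral_distr) auto
    show ?thesis
    proof (cases "\<sigma> = 0")
      case True
      interpret R: prob_space "return borel (0::real)" by (rule prob_space_return) simp
      \<comment> \<open>\<open>0 ^ (2 * k)\<close> is 1 for \<open>k = 0\<close> and 0 otherwise,
        hence the later case split on \<open>k\<close>.\<close>
      have "integrable (return borel (0::real)) (\<lambda>x. x ^ (2 * k))"
        by (rule R.integrable_const_bound[where B = "0 ^ (2 * k)"]) (auto simp: AE_return)
      then show ?thesis using True
        unfolding int val D using R.prob_space by (cases k) (auto simp: integral_return)
    next
      case False
      with \<open>0 \<le> \<sigma>\<close> have "0 < \<sigma>" by simp
      from normal_moment_even[OF this, of 0 k] False show ?thesis
        unfolding int val D
        by (simp add: integrable_density integral_density has_bochner_integral_iff power_divide)
    qed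
  qed
  show "integrable M (\<lambda>\<omega>. Y \<omega> ^ (2 * k))" using I by blast
  \<comment> \<open>The case \<open>k = 1\<close> identifies \<open>\<sigma>\<close> squared as the
    variance, which eliminates \<open>\<sigma>\<close>.\<close>
  have "(LINT \<omega>|M. (Y \<omega>)\<^sup>2) = \<sigma>\<^sup>2" using I[of 1] by (simp add: fact_2)
  then show "(LINT \<omega>|M. Y \<omega> ^ (2 * k)) = fact (2 * k) / (2 ^ k * fact k) * (LINT \<omega>|M. (Y \<omega>)\<^sup>2) ^ k"
    using I[of k] by simp
qed

lemma centered_gaussian_process_single:
  assumes "centered_gaussian_process M I X" "i \<in> I"
  shows "centered_gaussian M (X i)"
  using assms(1)[unfolded centered_gaussian_process_def, rule_format, of "{i}" "\<lambda>_. 1"] assms(2)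
  by simp

lemma centered_gaussian_process_diff:
  assumes "centered_gaussian_process M I X" "i \<in> I" "j \<in> I" "i \<noteq> j"
  shows "centered_gaussian M (\<lambda>\<omega>. X i \<omega> - X j \<omega>)"
  \<comment> \<open>Distinct indices keep the coefficients 1 and -1 from falling on the same
    element.\<close>
  using assms(1)[unfolded centered_gaussian_process_def, rule_format, of "{i, j}" "\<lambda>l. if l = i then 1 else -1"]
    assms(2-) by simp

text \<open>Both squares expand into double sums whose terms agree by the covariance identity; the
  sets may overlap. The arbitrary index type allows a sum type later, when two simple functions are
  subtracted.\<close>

lemma gaussian_random_measure_isometry:
  fixes a :: "'i \<Rightarrow> real"
  assumes B: "gaussian_random_measure N \<mu> B" and J: "finite J"
    and A: "\<And>i. i \<in> J \<Longrightarrow> A i \<in> finite_measure_sets \<mu>"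
  shows "(\<integral>\<^sup>+\<omega>. ennreal ((\<Sum>i\<in>J. a i * B (A i) \<omega>)\<^sup>2) \<partial>N)
       = (\<integral>\<^sup>+u. ennreal ((\<Sum>i\<in>J. a i * indicator (A i) u)\<^sup>2) \<partial>\<mu>)"
proof -
  have pN: "prob_space N" and gp: "centered_gaussian_process N (finite_measure_sets \<mu>) B"
    and cov: "\<And>A A'. A \<in> finite_measure_sets \<mu> \<Longrightarrow> A' \<in> finite_measure_sets \<mu> \<Longrightarrow>
        (LINT \<omega>|N. B A \<omega> * B A' \<omega>) = measure \<mu> (A \<inter> A')"
    using B by (auto simp: gaussian_random_measure_def)
  have G: "centered_gaussian N (B (A i))" if "i \<in> J" for i
    using centered_gaussian_process_single[OF gp A[OF that]] .
  \<comment> \<open>The covariance identity only gives values of Bochner integrals; exchanging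
    integral and double sum also requires integrability, which follows from the squares.\<close>
  have intB: "integrable N (\<lambda>\<omega>. B (A i) \<omega> * B (A j) \<omega>)" if "i \<in> J" "j \<in> J" for i j
  proof (rule Bochner_Integration.integrable_bound)
    show "integrable N (\<lambda>\<omega>. B (A i) \<omega> ^ 2 + B (A j) \<omega> ^ 2)"
      using centered_gaussian_even_moment(1)[OF pN G, of _ 1] that by simp
    show "(\<lambda>\<omega>. B (A i) \<omega> * B (A j) \<omega>) \<in> borel_measurable N"
      using G[OF that(1)] G[OF that(2)] by (auto simp: centered_gaussian_def)
    have "\<bar>x * y\<bar> \<le> x ^ 2 + y ^ 2" for x y :: real
    proof -
      have "2 * (\<bar>x\<bar> * \<bar>y\<bar>) \<le> x\<^sup>2 + y\<^sup>2"
        using sum_squares_bound[of "\<bar>x\<bar>" "\<bar>y\<bar>"] by (simp add: mult.assoc)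
      moreover have "0 \<le> \<bar>x\<bar> * \<bar>y\<bar>" by simp
      ultimately show ?thesis unfolding abs_mult by linarith
    qed
    then show "AE \<omega> in N. norm (B (A i) \<omega> * B (A j) \<omega>) \<le> norm (B (A i) \<omega> ^ 2 + B (A j) \<omega> ^ 2)"
      by auto
  qed
  have sq: "(\<Sum>i\<in>J. c i)\<^sup>2 = (\<Sum>i\<in>J. \<Sum>j\<in>J. c i * c j)" for c :: "'i \<Rightarrow> real"
    by (simp add: power2_eq_square sum_product)
  have fin: "A i \<inter> A j \<in> sets \<mu>" "emeasure \<mu> (A i \<inter> A j) < \<infinity>" if "i \<in> J" "j \<in> J" for i j
    using A[OF that(1)] A[OF that(2)] le_less_trans[OF emeasure_mono[of "A i \<inter> A j" "A i" \<mu>]]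
    by (auto simp: finite_measure_sets_def)
  have intA: "integrable \<mu> (\<lambda>u. indicator (A i \<inter> A j) u :: real)" if "i \<in> J" "j \<in> J" for i j
    using fin[OF that] by (auto intro!: integrable_real_indicator)
  have "(LINT \<omega>|N. (\<Sum>i\<in>J. a i * B (A i) \<omega>)\<^sup>2) = (\<Sum>i\<in>J. \<Sum>j\<in>J. a i * a j * measure \<mu> (A i \<inter> A j))"
  proof -
    have "(\<Sum>i\<in>J. a i * B (A i) \<omega>)\<^sup>2 = (\<Sum>i\<in>J. \<Sum>j\<in>J. a i * a j * (B (A i) \<omega> * B (A j) \<omega>))" for \<omega>
      by (simp add: sq mult_ac)
    then show ?thesis
      using intB by (simp add: Bochner_Integration.integral_sum Bochner_Integration.integrable_sum cov A)
  qed
  also have "\<dots> = (LINT u|\<mu>. (\<Sum>i\<in>J. a i * indicator (A i) u)\<^sup>2)"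
  proof -
    have "(\<Sum>i\<in>J. a i * indicator (A i) u)\<^sup>2 = (\<Sum>i\<in>J. \<Sum>j\<in>J. a i * a j * indicator (A i \<inter> A j) u)" for u
      by (simp add: sq indicator_inter_arith mult_ac)
    then show ?thesis
      using intA fin by (simp add: Bochner_Integration.integral_sum Bochner_Integration.integrable_sum)
  qed
  finally have eq: "(LINT \<omega>|N. (\<Sum>i\<in>J. a i * B (A i) \<omega>)\<^sup>2) = (LINT u|\<mu>. (\<Sum>i\<in>J. a i * indicator (A i) u)\<^sup>2)" .
  have "integrable N (\<lambda>\<omega>. (\<Sum>i\<in>J. a i * B (A i) \<omega>)\<^sup>2)"
  proof -
    have "integrable N (\<lambda>\<omega>. \<Sum>i\<in>J. \<Sum>j\<in>J. a i * a j * (B (A i) \<omega> * B (A j) \<omega>))"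
      using intB by (intro Bochner_Integration.integrable_sum) auto
    then show ?thesis by (simp add: sq mult_ac)
  qed
  moreover have "integrable \<mu> (\<lambda>u. (\<Sum>i\<in>J. a i * indicator (A i) u)\<^sup>2)"
  proof -
    have "integrable \<mu> (\<lambda>u. \<Sum>i\<in>J. \<Sum>j\<in>J. a i * a j * indicator (A i \<inter> A j) u)"
      using intA by (intro Bochner_Integration.integrable_sum) auto
    then show ?thesis by (simp add: sq indicator_inter_arith mult_ac)
  qed
  ultimately show ?thesis
    using eq by (simp add: nn_integral_eq_integral)
qed

text \<open>Only bounds up to constants matter here, so Minkowski's inequality is replaced by this crude one;
  applying it on both sides of the isometry produces the factor 9 below.\<close>

lemma nn_integral_power2_sum3_le:
  fixes f g h :: "'a \<Rightarrow> real"
  assumes [measurable]: "f \<in> borel_measurable M" "g \<in> borel_measurable M" "h \<in> borel_measurable M"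
    and F: "\<And>x. F x = f x + g x + h x"
  shows "(\<integral>\<^sup>+x. ennreal ((F x)\<^sup>2) \<partial>M) \<le>
    3 * ((\<integral>\<^sup>+x. ennreal ((f x)\<^sup>2) \<partial>M) + (\<integral>\<^sup>+x. ennreal ((g x)\<^sup>2) \<partial>M) + (\<integral>\<^sup>+x. ennreal ((h x)\<^sup>2) \<partial>M))"
proof -
  \<comment> \<open>The difference of the two sides is the sum of the squares of
    \<open>a - b\<close>, \<open>b - c\<close> and \<open>a - c\<close>.\<close>
  have "(a + b + c)\<^sup>2 \<le> 3 * (a\<^sup>2 + b\<^sup>2 + c\<^sup>2)" for a b c :: real
    using zero_le_power2[of "a - b"] zero_le_power2[of "b - c"] zero_le_power2[of "a - c"]
    by (simp add: power2_eq_square algebra_simps)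
  then have "(\<integral>\<^sup>+x. ennreal ((F x)\<^sup>2) \<partial>M) \<le> (\<integral>\<^sup>+x. ennreal (3 * ((f x)\<^sup>2 + (g x)\<^sup>2 + (h x)\<^sup>2)) \<partial>M)"
    unfolding F by (intro nn_integral_mono ennreal_leI)
  also have "\<dots> = (\<integral>\<^sup>+x. 3 * (ennreal ((f x)\<^sup>2) + ennreal ((g x)\<^sup>2) + ennreal ((h x)\<^sup>2)) \<partial>M)"
    by (simp add: ennreal_mult'')
  also have "\<dots> = 3 * ((\<integral>\<^sup>+x. ennreal ((f x)\<^sup>2) \<partial>M) + (\<integral>\<^sup>+x. ennreal ((g x)\<^sup>2) \<partial>M) + (\<integral>\<^sup>+x. ennreal ((h x)\<^sup>2) \<partial>M))"
    by (simp add: nn_integral_cmult nn_integral_add)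
  finally show ?thesis .
qed

text \<open>The approximations of \<open>Y\<close> and \<open>Z\<close> are subtracted directly,
  without first forming an integral of \<open>f - g\<close>. The isometry holds for the simple
  functions, and the approximation errors vanish in the limit.\<close>

lemma wiener_integral_diff_bound:
  fixes \<mu> :: "'c measure"
  assumes B: "gaussian_random_measure N \<mu> B"
    and Y: "is_wiener_integral N \<mu> B f Y" and Z: "is_wiener_integral N \<mu> B g Z"
  shows "(\<integral>\<^sup>+\<omega>. ennreal ((Y \<omega> - Z \<omega>)\<^sup>2) \<partial>N) \<le> 9 * (\<integral>\<^sup>+u. ennreal ((f u - g u)\<^sup>2) \<partial>\<mu>)"
proof -
  from Y obtain n :: "nat \<Rightarrow> nat" and a :: "nat \<Rightarrow> nat \<Rightarrow> real" and A :: "nat \<Rightarrow> nat \<Rightarrow> 'c set" where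
      mY[measurable]: "f \<in> borel_measurable \<mu>" "Y \<in> borel_measurable N"
    and A0: "\<forall>k. \<forall>i<n k. A k i \<in> finite_measure_sets \<mu>"
    and f: "(\<lambda>k. \<integral>\<^sup>+u. ennreal (((\<Sum>i<n k. a k i * indicator (A k i) u) - f u)\<^sup>2) \<partial>\<mu>) \<longlonglongrightarrow> 0"
    and Yl: "(\<lambda>k. \<integral>\<^sup>+\<omega>. ennreal (((\<Sum>i<n k. a k i * B (A k i) \<omega>) - Y \<omega>)\<^sup>2) \<partial>N) \<longlonglongrightarrow> 0"
    unfolding is_wiener_integral_def by (elim conjE exE) (rule that, assumption+)
  from Z obtain m :: "nat \<Rightarrow> nat" and b :: "nat \<Rightarrow> nat \<Rightarrow> real" and C :: "nat \<Rightarrow> nat \<Rightarrow> 'c set" where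
      mZ[measurable]: "g \<in> borel_measurable \<mu>" "Z \<in> borel_measurable N"
    and C0: "\<forall>k. \<forall>i<m k. C k i \<in> finite_measure_sets \<mu>"
    and g: "(\<lambda>k. \<integral>\<^sup>+u. ennreal (((\<Sum>i<m k. b k i * indicator (C k i) u) - g u)\<^sup>2) \<partial>\<mu>) \<longlonglongrightarrow> 0"
    and Zl: "(\<lambda>k. \<integral>\<^sup>+\<omega>. ennreal (((\<Sum>i<m k. b k i * B (C k i) \<omega>) - Z \<omega>)\<^sup>2) \<partial>N) \<longlonglongrightarrow> 0"
    unfolding is_wiener_integral_def by (elim conjE exE) (rule that, assumption+)
  have A: "A k i \<in> finite_measure_sets \<mu>" if "i < n k" for k i using A0 that by blast
  have C: "C k i \<in> finite_measure_sets \<mu>" if "i < m k" for k i using C0 that by blast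
  define fk where "fk k u = (\<Sum>i<n k. a k i * indicator (A k i) u)" for k u
  define gk where "gk k u = (\<Sum>i<m k. b k i * indicator (C k i) u)" for k u
  define Yk where "Yk k \<omega> = (\<Sum>i<n k. a k i * B (A k i) \<omega>)" for k \<omega>
  define Zk where "Zk k \<omega> = (\<Sum>i<m k. b k i * B (C k i) \<omega>)" for k \<omega>
  have gp: "centered_gaussian_process N (finite_measure_sets \<mu>) B"
    using B by (simp add: gaussian_random_measure_def)
  have mB: "B D \<in> borel_measurable N" if "D \<in> finite_measure_sets \<mu>" for D
    using centered_gaussian_process_single[OF gp that] by (simp add: centered_gaussian_def)
  have [measurable]: "Yk k \<in> borel_measurable N" "Zk k \<in> borel_measurable N" for k
    unfolding Yk_def[abs_def] Zk_def[abs_def]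
    by (auto intro!: borel_measurable_sum borel_measurable_times mB A C)
  have [measurable]: "fk k \<in> borel_measurable \<mu>" "gk k \<in> borel_measurable \<mu>" for k
    using A C unfolding fk_def[abs_def] gk_def[abs_def] finite_measure_sets_def
    by (intro borel_measurable_sum borel_measurable_times borel_measurable_indicator
        borel_measurable_const; simp)+
  have iso: "(\<integral>\<^sup>+\<omega>. ennreal ((Yk k \<omega> - Zk k \<omega>)\<^sup>2) \<partial>N) = (\<integral>\<^sup>+u. ennreal ((fk k u - gk k u)\<^sup>2) \<partial>\<mu>)" for k
  proof -
    \<comment> \<open>The disjoint union of the index sets turns the difference of two simple
      functions into a single one.\<close>
    define J where "J = {..<n k} <+> {..<m k}"
    define b' where "b' = case_sum (a k) (\<lambda>i. - b k i)"
    define D where "D = case_sum (A k) (C k)"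
    have J: "finite J" by (simp add: J_def)
    have mem: "D i \<in> finite_measure_sets \<mu>" if "i \<in> J" for i
      using that A C by (auto simp: J_def D_def)
    have "(\<Sum>i\<in>J. b' i * B (D i) \<omega>) = Yk k \<omega> - Zk k \<omega>" for \<omega>
      unfolding J_def by (subst sum.Plus) (simp_all add: o_def b'_def D_def sum_negf Yk_def Zk_def)
    moreover have "(\<Sum>i\<in>J. b' i * indicator (D i) u) = fk k u - gk k u" for u
      unfolding J_def by (subst sum.Plus) (simp_all add: o_def b'_def D_def sum_negf fk_def gk_def)
    ultimately show ?thesis
      using gaussian_random_measure_isometry[OF B J, of D b'] mem by simp
  qed
  define e where "e k = (\<integral>\<^sup>+u. ennreal ((fk k u - f u)\<^sup>2) \<partial>\<mu>)" for k
  define e' where "e' k = (\<integral>\<^sup>+u. ennreal ((gk k u - g u)\<^sup>2) \<partial>\<mu>)" for k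
  define d where "d k = (\<integral>\<^sup>+\<omega>. ennreal ((Yk k \<omega> - Y \<omega>)\<^sup>2) \<partial>N)" for k
  define d' where "d' k = (\<integral>\<^sup>+\<omega>. ennreal ((Zk k \<omega> - Z \<omega>)\<^sup>2) \<partial>N)" for k
  define I where "I = (\<integral>\<^sup>+u. ennreal ((f u - g u)\<^sup>2) \<partial>\<mu>)"
  have lims: "e \<longlonglongrightarrow> 0" "e' \<longlonglongrightarrow> 0" "d \<longlonglongrightarrow> 0" "d' \<longlonglongrightarrow> 0"
    using f g Yl Zl by (simp_all add: e_def[abs_def] e'_def[abs_def] d_def[abs_def] d'_def[abs_def]
        fk_def gk_def Yk_def Zk_def)
  have "(\<integral>\<^sup>+\<omega>. ennreal ((Y \<omega> - Z \<omega>)\<^sup>2) \<partial>N) \<le> 3 * (d k + 3 * (e k + I + e' k) + d' k)" for k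
  proof -
    have "(\<integral>\<^sup>+u. ennreal ((fk k u - gk k u)\<^sup>2) \<partial>\<mu>)
      \<le> 3 * ((\<integral>\<^sup>+u. ennreal ((fk k u - f u)\<^sup>2) \<partial>\<mu>) + (\<integral>\<^sup>+u. ennreal ((f u - g u)\<^sup>2) \<partial>\<mu>) +
             (\<integral>\<^sup>+u. ennreal ((g u - gk k u)\<^sup>2) \<partial>\<mu>))"
      by (rule nn_integral_power2_sum3_le) auto
    then have 1: "(\<integral>\<^sup>+\<omega>. ennreal ((Yk k \<omega> - Zk k \<omega>)\<^sup>2) \<partial>N) \<le> 3 * (e k + I + e' k)"
      by (simp add: e_def e'_def I_def iso power2_commute[of "g _"])
    have "(\<integral>\<^sup>+\<omega>. ennreal ((Y \<omega> - Z \<omega>)\<^sup>2) \<partial>N)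
      \<le> 3 * ((\<integral>\<^sup>+\<omega>. ennreal ((Y \<omega> - Yk k \<omega>)\<^sup>2) \<partial>N) + (\<integral>\<^sup>+\<omega>. ennreal ((Yk k \<omega> - Zk k \<omega>)\<^sup>2) \<partial>N) +
             (\<integral>\<^sup>+\<omega>. ennreal ((Zk k \<omega> - Z \<omega>)\<^sup>2) \<partial>N))"
      by (rule nn_integral_power2_sum3_le) auto
    also have "\<dots> \<le> 3 * (d k + 3 * (e k + I + e' k) + d' k)"
      using 1 by (intro mult_left_mono add_mono) (auto simp: d_def d'_def power2_commute[of "Y _"])
    finally show ?thesis .
  qed
  moreover have "(\<lambda>k. 3 * (d k + 3 * (e k + I + e' k) + d' k)) \<longlonglongrightarrow> 3 * (0 + 3 * (0 + I + 0) + 0)"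
    by (intro ennreal_tendsto_cmult tendsto_add lims tendsto_const) auto
  ultimately have "(\<integral>\<^sup>+\<omega>. ennreal ((Y \<omega> - Z \<omega>)\<^sup>2) \<partial>N) \<le> 3 * (0 + 3 * (0 + I + 0) + 0)"
    by (intro LIMSEQ_le_const) auto
  also have "\<dots> = 9 * I" by (simp add: mult.assoc[symmetric])
  finally show ?thesis by (simp add: I_def)
qed

subsection \<open>The rescaled kernel\<close>

text \<open>An integrable majorant needs separate exponents: \<open>a\<close> for the singularity at
  0 and \<open>b\<close> for the decay at infinity.\<close>

definition two_power :: "real \<Rightarrow> real \<Rightarrow> real \<Rightarrow> real" where
  "two_power a b x = (if \<bar>x\<bar> \<le> 1 then \<bar>x\<bar> powr a else \<bar>x\<bar> powr b)"

lemma two_power_nonneg: "0 \<le> two_power a b x"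
  by (simp add: two_power_def)

lemma borel_measurable_two_power [measurable]: "two_power a b \<in> borel_measurable borel"
  unfolding two_power_def[abs_def] by measurable

lemma nn_integral_two_power_finite:
  assumes "-1 < a" and "b < -1"
  shows "(\<integral>\<^sup>+x. ennreal (two_power a b x) \<partial>lborel) < \<infinity>"
proof -
  \<comment> \<open>\<open>E\<close> is the positive half. Both indicators contain 1, so the
    comparison with \<open>two_power\<close> below is only an inequality.\<close>
  define E where "E x = ennreal (x powr a) * indicator {0..1} x + ennreal (x powr b) * indicator {1..} x" for x
  have [measurable]: "E \<in> borel_measurable borel" unfolding E_def[abs_def] by measurable
  have "(\<integral>\<^sup>+x. E x \<partial>lborel) = (\<integral>\<^sup>+x. ennreal (x powr a) * indicator {0..1} x \<partial>lborel)
      + (\<integral>\<^sup>+x. ennreal (x powr b) * indicator {1..} x \<partial>lborel)"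
    unfolding E_def by (rule nn_integral_add) auto
  also have "\<dots> < \<infinity>"
    using nn_integral_has_integral_lebesgue'[OF _ has_integral_powr_from_0[OF assms(1), of 1]]
      nn_integral_has_integral_lebesgue'[OF _ has_integral_powr_to_inf[OF assms(2), of 1]]
    by simp
  finally have E: "(\<integral>\<^sup>+x. E x \<partial>lborel) < \<infinity>" .
  have "(\<integral>\<^sup>+x. ennreal (two_power a b x) \<partial>lborel) \<le> (\<integral>\<^sup>+x. E x + E (-x) \<partial>lborel)"
    by (intro nn_integral_mono) (auto simp: two_power_def E_def indicator_def abs_if)
  also have "\<dots> = (\<integral>\<^sup>+x. E x \<partial>lborel) + (\<integral>\<^sup>+x. E (-x) \<partial>lborel)"
    by (rule nn_integral_add) auto
  also have "(\<integral>\<^sup>+x. E (-x) \<partial>lborel) = (\<integral>\<^sup>+x. E x \<partial>lborel)"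
    using nn_integral_real_affine[of E "-1" 0] by simp
  finally show ?thesis using E by (auto elim: le_less_trans)
qed

text \<open>Both exponents are nonpositive, so replacing the larger base by the smaller one
  increases the product.\<close>

lemma powr_mult_powr_le:
  fixes x y p g :: real
  assumes "0 < x" "p \<le> 0" "0 \<le> g"
  shows "x powr p * \<bar>y\<bar> powr - g \<le> (if x \<le> \<bar>y\<bar> then x powr (p - g) else \<bar>y\<bar> powr (p - g))"
proof (cases "x \<le> \<bar>y\<bar>")
  case True
  then have "\<bar>y\<bar> powr - g \<le> x powr - g" using assms by (intro powr_mono2') auto
  then have "x powr p * \<bar>y\<bar> powr - g \<le> x powr p * x powr - g" by (intro mult_left_mono) auto
  then show ?thesis using True by (simp add: powr_add[symmetric])
next
  case False
  \<comment> \<open>For \<open>y = 0\<close> both sides vanish, since \<open>0 powr z\<close> is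
    0.\<close>
  show ?thesis
  proof (cases "y = 0")
    case False
    then have "x powr p \<le> \<bar>y\<bar> powr p" using \<open>\<not> x \<le> \<bar>y\<bar>\<close> assms by (intro powr_mono2') auto
    then have "x powr p * \<bar>y\<bar> powr - g \<le> \<bar>y\<bar> powr p * \<bar>y\<bar> powr - g" by (intro mult_right_mono) auto
    then show ?thesis using \<open>\<not> x \<le> \<bar>y\<bar>\<close> by (simp add: powr_add[symmetric])
  qed simp
qed

text \<open>The smaller of \<open>x\<close> and \<open>\<bar>y\<bar>\<close> is at most 1, so only
  the inner exponent is involved and \<open>b\<close> is free.\<close>

lemma powr_mult_powr_le_near:
  assumes "0 < x" "x \<le> 1" "p \<le> 0" "0 \<le> g"
  shows "x powr p * \<bar>y\<bar> powr - g \<le> two_power (p - g) b x + two_power (p - g) b y"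
  using powr_mult_powr_le[of x p g y] assms
  by (auto simp: two_power_def intro: add_increasing add_increasing2 split: if_splits)

text \<open>For \<open>\<bar>y\<bar> \<le> 1\<close> the power of \<open>x\<close> is at most 1 and
  \<open>a\<close> absorbs the singularity in \<open>y\<close>; otherwise both bases exceed 1 and
  the combined power has the outer exponent.\<close>

lemma powr_mult_powr_le_far:
  assumes "1 < x" "q \<le> 0" "0 \<le> g" "a \<le> - g"
  shows "x powr q * \<bar>y\<bar> powr - g \<le> two_power a (q - g) x + two_power a (q - g) y"
proof (cases "\<bar>y\<bar> \<le> 1")
  case True
  have "x powr q \<le> 1" using powr_mono[of q 0 x] assms by simp
  then have "x powr q * \<bar>y\<bar> powr - g \<le> \<bar>y\<bar> powr - g" by (simp add: mult_left_le_one_le)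
  also have "\<dots> \<le> \<bar>y\<bar> powr a" using True assms by (intro powr_mono') auto
  finally show ?thesis using two_power_nonneg[of a "q - g" x] True by (simp add: two_power_def)
next
  case False
  then show ?thesis
    using powr_mult_powr_le[of x q g y] assms
    by (auto simp: two_power_def intro: add_increasing add_increasing2 split: if_splits)
qed

text \<open>The kernel increment in units of \<open>t - s\<close>, without its weight; the terms in
  \<open>- u\<close> cancel between the two times.\<close>

definition unit_increment :: "real \<Rightarrow> real \<Rightarrow> real" where
  "unit_increment \<alpha> w = pos_powr (1 + w) \<alpha> - pos_powr w \<alpha>"

lemma borel_measurable_pos_powr [measurable]: "(\<lambda>x. pos_powr x \<alpha>) \<in> borel_measurable borel"
  unfolding pos_powr_def[abs_def] by measurable

text \<open>A difference of nonnegative numbers is at most a common upper bound: 2 for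
  \<open>0 \<le> \<alpha>\<close>, and \<open>w powr \<alpha>\<close> for negative
  \<open>\<alpha>\<close>. The minimum in the exponent covers both cases.\<close>

lemma unit_increment_near:
  assumes "\<bar>\<alpha>\<bar> < 1" and "0 < w" "w \<le> 1"
  shows "(unit_increment \<alpha> w)\<^sup>2 \<le> 4 * w powr min (2 * \<alpha>) 0"
proof -
  have u: "unit_increment \<alpha> w = (1 + w) powr \<alpha> - w powr \<alpha>"
    using assms by (simp add: unit_increment_def pos_powr_def)
  have *: "(b - c)\<^sup>2 \<le> e\<^sup>2" if "0 \<le> b" "0 \<le> c" "b \<le> e" "c \<le> e" for b c e :: real
    by (rule power2_le_iff_abs_le[THEN iffD2]) (use that in auto)
  show ?thesis
  proof (cases "0 \<le> \<alpha>")
    case True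
    have "2 powr \<alpha> \<le> 2" using powr_mono[of \<alpha> 1 2] assms by simp
    moreover have "(1 + w) powr \<alpha> \<le> 2 powr \<alpha>" "w powr \<alpha> \<le> 2 powr \<alpha>"
      using assms True by (auto intro!: powr_mono2)
    ultimately have "(unit_increment \<alpha> w)\<^sup>2 \<le> 2\<^sup>2" unfolding u by (intro *) auto
    then show ?thesis using True assms by simp
  next
    case False
    have "(1 + w) powr \<alpha> \<le> w powr \<alpha>" using False assms by (intro powr_mono2') auto
    then have "(unit_increment \<alpha> w)\<^sup>2 \<le> (w powr \<alpha>)\<^sup>2" unfolding u by (intro *) auto
    also have "\<dots> = w powr (2 * \<alpha>)"
      by (simp add: power2_eq_square powr_add[symmetric])
    also have "\<dots> \<le> 4 * w powr (2 * \<alpha>)" by simp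
    finally show ?thesis using False by (simp add: min_def)
  qed
qed

text \<open>By the mean value theorem the increment is a derivative
  \<open>\<alpha> * z powr (\<alpha> - 1)\<close> with \<open>z > w\<close>, a decreasing power of
  \<open>z\<close>. The gained exponent -1 gives integrability at infinity.\<close>

lemma unit_increment_far:
  assumes "\<bar>\<alpha>\<bar> < 1" and "1 < w"
  shows "(unit_increment \<alpha> w)\<^sup>2 \<le> w powr (2 * \<alpha> - 2)"
proof -
  have u: "unit_increment \<alpha> w = (1 + w) powr \<alpha> - w powr \<alpha>"
    using assms by (simp add: unit_increment_def pos_powr_def)
  have "\<exists>z>w. z < 1 + w \<and> (1 + w) powr \<alpha> - w powr \<alpha> = (1 + w - w) * (\<alpha> * z powr (\<alpha> - 1))"
    using assms by (intro MVT2) (auto intro!: derivative_eq_intros simp: powr_diff)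
  then obtain z where z: "w < z" "unit_increment \<alpha> w = \<alpha> * z powr (\<alpha> - 1)" by (auto simp: u)
  have "\<bar>\<alpha> * z powr (\<alpha> - 1)\<bar> \<le> 1 * w powr (\<alpha> - 1)"
    unfolding abs_mult using assms z by (intro mult_mono) (auto intro!: powr_mono2')
  then have "(unit_increment \<alpha> w)\<^sup>2 \<le> (w powr (\<alpha> - 1))\<^sup>2"
    unfolding z(2) by (intro power2_le_iff_abs_le[THEN iffD2]) auto
  also have "\<dots> = w powr (2 * \<alpha> - 2)" by (simp add: power2_eq_square powr_add[symmetric])
  finally show ?thesis .
qed

text \<open>\<open>D\<close> is integrable in the given parameter range, and each summand is a translate or reflection of
  it, so the right-hand side has an integral that does not depend on \<open>a\<close>.\<close>

lemma unit_increment_weighted_le: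
  assumes "0 \<le> \<gamma>" and \<alpha>: "\<bar>\<alpha>\<bar> < 1"
  defines "D \<equiv> two_power (min (2 * \<alpha>) 0 - \<gamma>) (2 * \<alpha> - 2 - \<gamma>)"
  shows "(unit_increment \<alpha> w)\<^sup>2 * \<bar>a - w\<bar> powr - \<gamma> \<le> 4 * (D (1 + w) + D w + D (a - w))"
proof -
  have D: "0 \<le> D x" for x by (simp add: D_def two_power_nonneg)
  have weight: "(unit_increment \<alpha> w)\<^sup>2 * \<bar>a - w\<bar> powr - \<gamma> \<le> 4 * (v * \<bar>a - w\<bar> powr - \<gamma>)"
    if "(unit_increment \<alpha> w)\<^sup>2 \<le> 4 * v" for v
    using mult_right_mono[OF that, of "\<bar>a - w\<bar> powr - \<gamma>"] by (simp add: mult.assoc)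
  \<comment> \<open>The regions: no power active; only the first, singular at -1; both, singular at
    0; the tail.\<close>
  consider "w \<le> -1" | "-1 < w" "w \<le> 0" | "0 < w" "w \<le> 1" | "1 < w" by linarith
  then show ?thesis
  proof cases
    case 1
    then show ?thesis using D by (simp add: unit_increment_def pos_powr_def)
  next
    case 2
    have "(unit_increment \<alpha> w)\<^sup>2 = (1 + w) powr (2 * \<alpha>)"
      using 2 by (simp add: unit_increment_def pos_powr_def power2_eq_square powr_add[symmetric])
    \<comment> \<open>The base is at most 1, so lowering the exponent increases the power; the
      exponent must be nonpositive for the product estimate.\<close>
    also have "\<dots> \<le> (1 + w) powr (min (2 * \<alpha>) 0)" using 2 by (intro powr_mono') auto
    finally have "(unit_increment \<alpha> w)\<^sup>2 \<le> 4 * (1 + w) powr (min (2 * \<alpha>) 0)"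
      using powr_ge_zero[of "1 + w" "min (2 * \<alpha>) 0"] by linarith
    from weight[OF this] powr_mult_powr_le_near[of "1 + w" "min (2 * \<alpha>) 0" \<gamma> "a - w" "2 * \<alpha> - 2 - \<gamma>"] 2 assms(1) D[of w]
    show ?thesis by (simp add: D_def)
  next
    case 3
    from weight[OF unit_increment_near[OF \<alpha> 3]] powr_mult_powr_le_near[of w "min (2 * \<alpha>) 0" \<gamma> "a - w" "2 * \<alpha> - 2 - \<gamma>"] 3 assms(1) D[of "1 + w"]
    show ?thesis by (simp add: D_def)
  next
    case 4
    have "(unit_increment \<alpha> w)\<^sup>2 \<le> 4 * w powr (2 * \<alpha> - 2)"
      using unit_increment_far[OF \<alpha> 4] powr_ge_zero[of w "2 * \<alpha> - 2"] by linarith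
    moreover have "\<alpha> \<le> 1" using \<alpha> by linarith
    ultimately show ?thesis
      using weight[of "w powr (2 * \<alpha> - 2)"] powr_mult_powr_le_far[of w "2 * \<alpha> - 2" \<gamma> "min (2 * \<alpha>) 0 - \<gamma>" "a - w"] 4 assms(1) D[of "1 + w"]
      by (simp add: D_def)
  qed
qed

lemma unit_increment_weighted_integral_bounded:
  assumes "0 \<le> \<gamma>" "\<gamma> < 1" "- 1/2 + \<gamma>/2 < \<alpha>" "\<alpha> < 1/2 + \<gamma>/2"
  obtains C :: real where "0 \<le> C"
    and "\<And>a. (\<integral>\<^sup>+w. ennreal ((unit_increment \<alpha> w)\<^sup>2 * \<bar>a - w\<bar> powr - \<gamma>) \<partial>lborel) \<le> ennreal C"
proof -
  define D where "D = two_power (min (2 * \<alpha>) 0 - \<gamma>) (2 * \<alpha> - 2 - \<gamma>)"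
  have [measurable]: "D \<in> borel_measurable borel" by (simp add: D_def)
  have D: "0 \<le> D x" for x by (simp add: D_def two_power_nonneg)
  define J where "J = (\<integral>\<^sup>+x. ennreal (D x) \<partial>lborel)"
  \<comment> \<open>The conditions \<open>-1 < min (2 * \<alpha>) 0 - \<gamma>\<close> and
    \<open>2 * \<alpha> - 2 - \<gamma> < -1\<close> follow from the lower bound on
    \<open>\<alpha>\<close> with \<open>\<gamma> < 1\<close>, and from the upper bound on
    \<open>\<alpha>\<close>.\<close>
  have J: "J < \<infinity>"
    unfolding J_def D_def using assms by (intro nn_integral_two_power_finite) auto
  have "(\<integral>\<^sup>+w. ennreal ((unit_increment \<alpha> w)\<^sup>2 * \<bar>a - w\<bar> powr - \<gamma>) \<partial>lborel) \<le> 4 * (J + J + J)" for a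
  proof -
    have "(\<integral>\<^sup>+w. ennreal ((unit_increment \<alpha> w)\<^sup>2 * \<bar>a - w\<bar> powr - \<gamma>) \<partial>lborel)
        \<le> (\<integral>\<^sup>+w. ennreal (4 * (D (1 + w) + D w + D (a - w))) \<partial>lborel)"
      unfolding D_def using assms by (intro nn_integral_mono ennreal_leI unit_increment_weighted_le) auto
    also have "\<dots> = (\<integral>\<^sup>+w. 4 * (ennreal (D (1 + w)) + ennreal (D w) + ennreal (D (a - w))) \<partial>lborel)"
      using D by (simp add: ennreal_mult'')
    also have "\<dots> = 4 * ((\<integral>\<^sup>+w. ennreal (D (1 + w)) \<partial>lborel) + J + (\<integral>\<^sup>+w. ennreal (D (a - w)) \<partial>lborel))"
      by (simp add: nn_integral_cmult nn_integral_add J_def)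
    also have "(\<integral>\<^sup>+w. ennreal (D (1 + w)) \<partial>lborel) = J"
      using nn_integral_real_affine[of "\<lambda>x. ennreal (D x)" 1 1] by (simp add: J_def)
    also have "(\<integral>\<^sup>+w. ennreal (D (a - w)) \<partial>lborel) = J"
      using nn_integral_real_affine[of "\<lambda>x. ennreal (D x)" "-1" a] by (simp add: J_def)
    finally show ?thesis .
  qed
  moreover have "4 * (J + J + J) < top"
    using J by (simp add: ennreal_mult_less_top)
  ultimately show ?thesis by (intro that[of "enn2real (4 * (J + J + J))"]) auto
qed

text \<open>Homogeneity: with \<open>u = s - h * w\<close>, the quantities \<open>t - u\<close>,
  \<open>s - u\<close> and \<open>\<bar>u\<bar>\<close> all carry a factor \<open>h = t - s\<close>,
  which comes out with degree \<open>\<alpha>\<close> from the powers and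
  \<open>- \<gamma> / 2\<close> from the weight.\<close>

lemma gfbm_kernel_diff_rescaled:
  assumes "s < t"
  shows "(gfbm_kernel \<alpha> \<gamma> t (s - (t - s) * w) - gfbm_kernel \<alpha> \<gamma> s (s - (t - s) * w))\<^sup>2
       = (t - s) powr (2 * \<alpha> - \<gamma>) * ((unit_increment \<alpha> w)\<^sup>2 * \<bar>s / (t - s) - w\<bar> powr - \<gamma>)"
proof -
  define h where "h = t - s"
  have h: "0 < h" using assms by (simp add: h_def)
  have pp: "pos_powr (h * x) \<alpha> = h powr \<alpha> * pos_powr x \<alpha>" for x
    using h by (auto simp: pos_powr_def powr_mult zero_less_mult_iff)
  define u where "u = s - h * w"
  have u: "t - u = h * (1 + w)" "s - u = h * w"
    by (simp_all add: u_def h_def algebra_simps)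
  have abs_u: "\<bar>u\<bar> = h * \<bar>s / h - w\<bar>"
  proof -
    have "u = h * (s / h - w)" using h by (simp add: u_def right_diff_distrib)
    then show ?thesis using h by (simp add: abs_mult)
  qed
  have "gfbm_kernel \<alpha> \<gamma> t u - gfbm_kernel \<alpha> \<gamma> s u
      = (pos_powr (t - u) \<alpha> - pos_powr (s - u) \<alpha>) * \<bar>u\<bar> powr (- \<gamma> / 2)"
    by (simp add: gfbm_kernel_def left_diff_distrib)
  also have "\<dots> = h powr \<alpha> * unit_increment \<alpha> w * \<bar>u\<bar> powr (- \<gamma> / 2)"
    unfolding u pp unit_increment_def by (simp add: right_diff_distrib)
  also have "\<bar>u\<bar> powr (- \<gamma> / 2) = h powr (- \<gamma> / 2) * \<bar>s / h - w\<bar> powr (- \<gamma> / 2)"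
    using h unfolding abs_u by (simp only: powr_mult)
  finally have "(gfbm_kernel \<alpha> \<gamma> t u - gfbm_kernel \<alpha> \<gamma> s u)\<^sup>2
      = (h powr \<alpha> * h powr \<alpha> * (h powr (- \<gamma> / 2) * h powr (- \<gamma> / 2)))
        * ((unit_increment \<alpha> w)\<^sup>2 * (\<bar>s / h - w\<bar> powr (- \<gamma> / 2) * \<bar>s / h - w\<bar> powr (- \<gamma> / 2)))"
    by (simp add: power2_eq_square mult_ac)
  then show ?thesis unfolding powr_add[symmetric] by (simp add: h_def u_def)
qed

text \<open>The Jacobian \<open>t - s\<close> raises the exponent
  \<open>2 * \<alpha> - \<gamma>\<close> by one. The position \<open>s\<close> survives only as the
  shift \<open>s / (t - s)\<close>, over which the integral bound is uniform.\<close>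

lemma gfbm_kernel_diff_bound:
  assumes "0 \<le> \<gamma>" "\<gamma> < 1" "- 1/2 + \<gamma>/2 < \<alpha>" "\<alpha> < 1/2 + \<gamma>/2"
  obtains C :: real where "0 \<le> C"
    and "\<And>s t. s < t \<Longrightarrow> (\<integral>\<^sup>+u. ennreal ((gfbm_kernel \<alpha> \<gamma> t u - gfbm_kernel \<alpha> \<gamma> s u)\<^sup>2) \<partial>lborel)
      \<le> ennreal (C * (t - s) powr (2 * \<alpha> - \<gamma> + 1))"
proof -
  obtain C :: real where C: "0 \<le> C"
    "\<And>a. (\<integral>\<^sup>+w. ennreal ((unit_increment \<alpha> w)\<^sup>2 * \<bar>a - w\<bar> powr - \<gamma>) \<partial>lborel) \<le> ennreal C"
    using unit_increment_weighted_integral_bounded[OF assms] by blast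
  have "(\<integral>\<^sup>+u. ennreal ((gfbm_kernel \<alpha> \<gamma> t u - gfbm_kernel \<alpha> \<gamma> s u)\<^sup>2) \<partial>lborel)
      \<le> ennreal (C * (t - s) powr (2 * \<alpha> - \<gamma> + 1))" if "s < t" for s t
  proof -
    have [measurable]: "gfbm_kernel \<alpha> \<gamma> t \<in> borel_measurable borel" for t
      unfolding gfbm_kernel_def[abs_def] by measurable
    have [measurable]: "unit_increment \<alpha> \<in> borel_measurable borel"
      unfolding unit_increment_def[abs_def] by measurable
    define P where "P w = (unit_increment \<alpha> w)\<^sup>2 * \<bar>s / (t - s) - w\<bar> powr - \<gamma>" for w
    have [measurable]: "P \<in> borel_measurable borel" unfolding P_def[abs_def] by measurable
    have "(\<integral>\<^sup>+u. ennreal ((gfbm_kernel \<alpha> \<gamma> t u - gfbm_kernel \<alpha> \<gamma> s u)\<^sup>2) \<partial>lborel)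
      = ennreal (t - s) * (\<integral>\<^sup>+w. ennreal ((gfbm_kernel \<alpha> \<gamma> t (s - (t - s) * w) - gfbm_kernel \<alpha> \<gamma> s (s - (t - s) * w))\<^sup>2) \<partial>lborel)"
    proof -
      have "s + - (t - s) * w = s - (t - s) * w" for w by (simp add: algebra_simps)
      then show ?thesis
        using that nn_integral_real_affine[of "\<lambda>u. ennreal ((gfbm_kernel \<alpha> \<gamma> t u - gfbm_kernel \<alpha> \<gamma> s u)\<^sup>2)" "- (t - s)" s]
        by (simp only: abs_minus_cancel abs_of_pos) simp
    qed
    also have "\<dots> = ennreal (t - s) * (\<integral>\<^sup>+w. ennreal ((t - s) powr (2 * \<alpha> - \<gamma>)) * ennreal (P w) \<partial>lborel)"
      unfolding gfbm_kernel_diff_rescaled[OF that] P_def by (simp add: ennreal_mult')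
    also have "\<dots> = ennreal (t - s) * (ennreal ((t - s) powr (2 * \<alpha> - \<gamma>)) * (\<integral>\<^sup>+w. ennreal (P w) \<partial>lborel))"
      by (simp add: nn_integral_cmult)
    also have "\<dots> \<le> ennreal (t - s) * (ennreal ((t - s) powr (2 * \<alpha> - \<gamma>)) * ennreal C)"
      unfolding P_def by (intro mult_left_mono C) auto
    also have "\<dots> = ennreal ((t - s) * ((t - s) powr (2 * \<alpha> - \<gamma>) * C))"
      using that C(1) by (simp add: ennreal_mult)
    also have "(t - s) * ((t - s) powr (2 * \<alpha> - \<gamma>) * C) = C * (t - s) powr (2 * \<alpha> - \<gamma> + 1)"
      using that by (simp add: powr_add)
    finally show ?thesis .
  qed
  with C(1) show ?thesis by (rule that)
qed

subsection \<open>Gaussian processes with Hoelder continuous paths\<close>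

lemma holder_on_rescale:
  assumes T: "0 < T" and f: "holder_on \<beta> {0..1} (\<lambda>x. f (T * x))"
  shows "holder_on \<beta> {0..T} f"
proof -
  obtain K where K: "\<And>s t. s \<in> {0..1} \<Longrightarrow> t \<in> {0..1} \<Longrightarrow> \<bar>f (T * s) - f (T * t)\<bar> \<le> K * \<bar>s - t\<bar> powr \<beta>"
    using f unfolding holder_on_def by blast
  have "\<bar>f s - f t\<bar> \<le> K / T powr \<beta> * \<bar>s - t\<bar> powr \<beta>" if "s \<in> {0..T}" "t \<in> {0..T}" for s t
  proof -
    have "\<bar>s / T - t / T\<bar> powr \<beta> = \<bar>s - t\<bar> powr \<beta> / T powr \<beta>"
      using T by (simp add: diff_divide_distrib[symmetric] powr_divide)
    then show ?thesis using K[of "s / T" "t / T"] that T by simp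
  qed
  then show ?thesis unfolding holder_on_def by blast
qed

text \<open>This is Kolmogorov's criterion for paths already known to be continuous. Gaussianity
  makes all even moments available, so every exponent below \<open>H\<close> is reached.\<close>

lemma gaussian_process_holder:
  fixes X :: "real \<Rightarrow> 'a \<Rightarrow> real"
  assumes M: "prob_space M" and X: "centered_gaussian_process M {0..} X"
    and cont: "AE \<omega> in M. continuous_on {0..} (\<lambda>t. X t \<omega>)"
    and C: "0 \<le> C" and bound: "\<And>s t. 0 \<le> s \<Longrightarrow> s < t \<Longrightarrow>
      (LINT \<omega>|M. (X t \<omega> - X s \<omega>)\<^sup>2) \<le> C * (t - s) powr (2 * H)"
    and \<beta>: "0 < \<beta>" "\<beta> < H" and T: "0 < T"
  shows "AE \<omega> in M. holder_on \<beta> {0..T} (\<lambda>t. X t \<omega>)"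
proof -
  have [measurable]: "X t \<in> borel_measurable M" if "0 \<le> t" for t
    using centered_gaussian_process_single[OF X, of t] that by (simp add: centered_gaussian_def)
  \<comment> \<open>The moment order \<open>2 * m\<close> must outweigh the \<open>2 ^ n\<close>
    increments at level \<open>n\<close>.\<close>
  obtain m :: nat where m: "1 < real m * (2 * (H - \<beta>))"
    using reals_Archimedean3[of "2 * (H - \<beta>)"] \<beta> by auto
  then have "0 < m" by (cases m) auto
  define c :: real where "c = fact (2 * m) / (2 ^ m * fact m)"
  have c: "0 \<le> c" by (simp add: c_def)
  define r where "r = 2 powr - \<beta>"
  have r: "0 < r" by (simp add: r_def)
  define \<Delta> where "\<Delta> n i \<omega> = X (T * (real (Suc i) / 2 ^ n)) \<omega> - X (T * (real i / 2 ^ n)) \<omega>" for n i :: nat and \<omega>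
  have [measurable]: "\<Delta> n i \<in> borel_measurable M" for n i
    unfolding \<Delta>_def[abs_def] using T by (intro borel_measurable_diff) auto
  \<comment> \<open>Per level, \<open>q\<close> collects the factor 2 from the number of increments,
    \<open>2 powr (-2mH)\<close> from the moment bound and \<open>2 powr (2m\<beta>)\<close> from
    the division by \<open>r ^ n\<close>; \<open>A\<close> holds the remaining constants.\<close>
  define A where "A = c * C ^ m * T powr (2 * H * real m)"
  define q where "q = 2 powr (1 - real m * (2 * (H - \<beta>)))"
  have A: "0 \<le> A" using c C by (simp add: A_def)
  have q: "0 < q" "q < 1" unfolding q_def using m powr_less_mono[of "1 - real m * (2 * (H - \<beta>))" 0 2] by auto
  \<comment> \<open>One random variable dominates all normalised increments at once, so a single
    null set suffices.\<close>
  define Z where "Z \<omega> = (\<Sum>n. \<Sum>i<2 ^ n. ennreal ((\<Delta> n i \<omega> / r ^ n) ^ (2 * m)))" for \<omega>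
  have moment: "(\<integral>\<^sup>+\<omega>. ennreal ((\<Delta> n i \<omega> / r ^ n) ^ (2 * m)) \<partial>M) \<le> ennreal (A * q ^ n / 2 ^ n)" for n i
  proof -
    define s t where "s = T * (real i / 2 ^ n)" and "t = T * (real (Suc i) / 2 ^ n)"
    have st: "0 \<le> s" "s < t" and diff: "t - s = T / 2 ^ n"
      using T by (auto simp: s_def t_def field_simps)
    have "centered_gaussian M (\<lambda>\<omega>. X t \<omega> - X s \<omega>)"
      using st by (intro centered_gaussian_process_diff[OF X]) auto
    then have G: "centered_gaussian M (\<Delta> n i)" by (simp only: \<Delta>_def[abs_def] s_def t_def)
    have "(LINT \<omega>|M. (\<Delta> n i \<omega>)\<^sup>2) \<le> C * (T / 2 ^ n) powr (2 * H)"
      using bound[OF st] unfolding diff by (simp add: \<Delta>_def s_def t_def)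
    then have "(LINT \<omega>|M. (\<Delta> n i \<omega>)\<^sup>2) ^ m \<le> (C * (T / 2 ^ n) powr (2 * H)) ^ m"
      by (intro power_mono) auto
    then have "(LINT \<omega>|M. \<Delta> n i \<omega> ^ (2 * m)) \<le> c * (C * (T / 2 ^ n) powr (2 * H)) ^ m"
      unfolding centered_gaussian_even_moment(2)[OF M G] c_def[symmetric] using c by (rule mult_left_mono)
    also have "\<dots> = c * C ^ m * (T powr (2 * H * real m) * 2 powr (- (2 * H * real m * real n)))"
    proof -
      have "((T / 2 ^ n) powr (2 * H)) ^ m = (T / 2 ^ n) powr (2 * H * real m)"
        using T by (simp add: powr_realpow[symmetric] powr_powr)
      also have "\<dots> = T powr (2 * H * real m) * 2 powr (- (2 * H * real m * real n))"
      proof -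
        have "(2 ^ n) powr (2 * H * real m) = 2 powr (2 * H * real m * real n)"
          by (simp add: powr_realpow[symmetric] powr_powr mult_ac)
        then show ?thesis using T by (simp add: powr_divide powr_minus_divide)
      qed
      finally show ?thesis by (simp add: power_mult_distrib)
    qed
    finally have le: "(LINT \<omega>|M. \<Delta> n i \<omega> ^ (2 * m)) \<le> A * 2 powr (- (2 * H * real m * real n))"
      by (simp add: A_def mult_ac)
    have "(\<integral>\<^sup>+\<omega>. ennreal ((\<Delta> n i \<omega> / r ^ n) ^ (2 * m)) \<partial>M) = ennreal (LINT \<omega>|M. (\<Delta> n i \<omega> / r ^ n) ^ (2 * m))"
      using centered_gaussian_even_moment(1)[OF M G, of m]
      by (intro nn_integral_eq_integral) (auto simp: power_divide)
    also have "(LINT \<omega>|M. (\<Delta> n i \<omega> / r ^ n) ^ (2 * m)) = (LINT \<omega>|M. \<Delta> n i \<omega> ^ (2 * m)) / (r ^ n) ^ (2 * m)"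
      by (simp add: power_divide)
    also have "\<dots> \<le> A * 2 powr (- (2 * H * real m * real n)) / (r ^ n) ^ (2 * m)"
      using le r by (intro divide_right_mono) auto
    \<comment> \<open>The exponents of 2 agree:
      \<open>-2Hmn + 2\<beta>mn = (1 - 2m(H - \<beta>))n - n\<close>.\<close>
    also have "\<dots> = A * q ^ n / 2 ^ n"
    proof -
      have "(r ^ n) ^ (2 * m) = 2 powr (- \<beta> * real n * real (2 * m))"
      proof -
        have "(r ^ n) ^ (2 * m) = r powr real (n * (2 * m))"
          using r unfolding power_mult[symmetric] by (simp only: powr_realpow)
        then show ?thesis by (simp only: r_def powr_powr of_nat_mult mult.assoc)
      qed
      moreover have "q ^ n / 2 ^ n = 2 powr ((1 - real m * (2 * (H - \<beta>))) * real n - real n)"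
      proof -
        have "q ^ n = q powr real n" using q by (simp add: powr_realpow)
        also have "\<dots> = 2 powr ((1 - real m * (2 * (H - \<beta>))) * real n)" by (simp only: q_def powr_powr)
        finally show ?thesis unfolding powr_diff by (simp only: powr_realpow[OF zero_less_numeral])
      qed
      moreover have "2 powr (- (2 * H * real m * real n)) / 2 powr (- \<beta> * real n * real (2 * m))
          = 2 powr ((1 - real m * (2 * (H - \<beta>))) * real n - real n)"
        unfolding powr_diff[symmetric] by (simp add: algebra_simps)
      ultimately show ?thesis by (simp only: times_divide_eq_right[symmetric])
    qed
    finally show ?thesis by (simp add: ennreal_leI)
  qed
  have "(\<integral>\<^sup>+\<omega>. Z \<omega> \<partial>M) = (\<Sum>n. \<Sum>i<2 ^ n. \<integral>\<^sup>+\<omega>. ennreal ((\<Delta> n i \<omega> / r ^ n) ^ (2 * m)) \<partial>M)"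
    unfolding Z_def by (simp add: nn_integral_suminf nn_integral_sum del: sum_ennreal)
  also have "\<dots> \<le> (\<Sum>n. ennreal (A * q ^ n))"
  proof (rule suminf_le)
    fix n :: nat
    \<comment> \<open>The \<open>2 ^ n\<close> increments cancel the denominator and leave a term of
      a geometric series.\<close>
    have "(\<Sum>i<2 ^ n. \<integral>\<^sup>+\<omega>. ennreal ((\<Delta> n i \<omega> / r ^ n) ^ (2 * m)) \<partial>M) \<le> (\<Sum>i<(2::nat) ^ n. ennreal (A * q ^ n / 2 ^ n))"
      by (intro sum_mono moment)
    also have "\<dots> = ennreal (A * q ^ n)"
      using A q by (simp add: sum_ennreal del: sum_constant) simp
    finally show "(\<Sum>i<2 ^ n. \<integral>\<^sup>+\<omega>. ennreal ((\<Delta> n i \<omega> / r ^ n) ^ (2 * m)) \<partial>M) \<le> ennreal (A * q ^ n)" .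
  qed auto
  also have "\<dots> < \<infinity>"
    using A q by (subst suminf_ennreal2) (auto intro!: summable_mult summable_geometric)
  finally have "AE \<omega> in M. Z \<omega> \<noteq> \<infinity>"
    by (intro nn_integral_PInf_AE) (auto simp: Z_def[abs_def])
  with cont show ?thesis
  proof eventually_elim
    case (elim \<omega>)
    then obtain z where z: "0 \<le> z" "Z \<omega> = ennreal z" by (cases "Z \<omega>") auto
    have incr: "\<bar>\<Delta> n i \<omega>\<bar> \<le> (1 + z) * r ^ n" if "i < 2 ^ n" for n i
    proof -
      define x where "x = \<bar>\<Delta> n i \<omega> / r ^ n\<bar>"
      have "ennreal ((\<Delta> n i \<omega> / r ^ n) ^ (2 * m)) \<le> (\<Sum>i<2 ^ n. ennreal ((\<Delta> n i \<omega> / r ^ n) ^ (2 * m)))"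
        using that by (intro member_le_sum) auto
      also have "\<dots> \<le> Z \<omega>"
        unfolding Z_def
        using sum_le_suminf[of "\<lambda>n. \<Sum>i<2 ^ n. ennreal ((\<Delta> n i \<omega> / r ^ n) ^ (2 * m))" "{n}"] by auto
      also have "(\<Delta> n i \<omega> / r ^ n) ^ (2 * m) = x ^ (2 * m)"
        unfolding x_def by (rule power_even_abs[symmetric]) simp
      finally have "x ^ (2 * m) \<le> z" using z by simp
      \<comment> \<open>Treating \<open>x \<le> 1\<close> separately gives the bound
        \<open>1 + z\<close> without extracting a root.\<close>
      moreover have "x \<le> x ^ (2 * m)" if "1 \<le> x"
        using that \<open>0 < m\<close> power_increasing[of 1 "2 * m" x] by simp
      ultimately have "x \<le> 1 + z" using z by (cases "1 \<le> x") auto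
      then show ?thesis using r by (simp add: x_def field_simps abs_divide)
    qed
    have "holder_on \<beta> {0..1} (\<lambda>x. X (T * x) \<omega>)"
    proof (rule holder_on_dyadic_increments[where K = "1 + z"])
      show "continuous_on {0..1} (\<lambda>x. X (T * x) \<omega>)"
        using T by (intro continuous_on_compose2[OF elim(1)] continuous_intros) auto
    qed (use \<beta> z incr in \<open>auto simp: \<Delta>_def r_def\<close>)
    then show ?case by (rule holder_on_rescale[OF T])
  qed
qed

subsection \<open>Generalized fractional Brownian motion\<close>

text \<open>Equality of laws moves the second moment to the space of the noise, where the Wiener
  integral bound and the kernel estimate apply.\<close>

lemma gfbm_incr_second_moment_bound:
  assumes par: "0 \<le> \<gamma>" "\<gamma> < 1" "- 1/2 + \<gamma>/2 < \<alpha>" "\<alpha> < 1/2 + \<gamma>/2"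
    and B: "gaussian_random_measure N lborel B" and X: "is_gfbm \<alpha> \<gamma> N B M X"
  obtains C :: real where "0 < C"
    and "\<And>s t. 0 \<le> s \<Longrightarrow> s < t \<Longrightarrow> incr_second_moment M X s t \<le> C * (t - s) powr (2 * \<alpha> - \<gamma> + 1)"
proof -
  obtain C :: real where C: "0 \<le> C"
    "\<And>s t. s < t \<Longrightarrow> (\<integral>\<^sup>+u. ennreal ((gfbm_kernel \<alpha> \<gamma> t u - gfbm_kernel \<alpha> \<gamma> s u)\<^sup>2) \<partial>lborel)
      \<le> ennreal (C * (t - s) powr (2 * \<alpha> - \<gamma> + 1))"
    using gfbm_kernel_diff_bound[OF par] by blast
  from X obtain I where I: "\<And>t. 0 \<le> t \<Longrightarrow> is_wiener_integral N lborel B (gfbm_kernel \<alpha> \<gamma> t) (I t)"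
    and law: "same_process_law {0..} M X N (\<lambda>t \<omega>. gfbm_const \<alpha> \<gamma> * I t \<omega>)"
    and gp: "centered_gaussian_process M {0..} X"
    by (auto simp: is_gfbm_def)
  have mX: "X t \<in> borel_measurable M" if "0 \<le> t" for t
    using centered_gaussian_process_single[OF gp, of t] that by (simp add: centered_gaussian_def)
  have mI: "I t \<in> borel_measurable N" if "0 \<le> t" for t
    using I[OF that] by (simp add: is_wiener_integral_def)
  define c where "c = gfbm_const \<alpha> \<gamma>"
  \<comment> \<open>Adding 1 makes the constant strictly positive.\<close>
  have "incr_second_moment M X s t \<le> (9 * c\<^sup>2 * C + 1) * (t - s) powr (2 * \<alpha> - \<gamma> + 1)"
    if st: "0 \<le> s" "s < t" for s t
  proof -
    have [measurable]: "X s \<in> borel_measurable M" "X t \<in> borel_measurable M"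
      "I s \<in> borel_measurable N" "I t \<in> borel_measurable N"
      using st by (auto intro: mX mI)
    have mem: "s \<in> {0..}" "t \<in> {0..}" using st by auto
    \<comment> \<open>The functional reads only two coordinates, so it is measurable for the
      uncountable product and can be integrated against either law.\<close>
    have F: "(\<lambda>x. ennreal ((x t - x s)\<^sup>2)) \<in> borel_measurable (Pi\<^sub>M {0..} (\<lambda>_::real. borel))"
      using measurable_component_singleton[OF mem(1), of "\<lambda>_. borel :: real measure"]
        measurable_component_singleton[OF mem(2), of "\<lambda>_. borel :: real measure"] by measurable
    have "(\<integral>\<^sup>+\<omega>. ennreal ((X t \<omega> - X s \<omega>)\<^sup>2) \<partial>M)
        = (\<integral>\<^sup>+x. ennreal ((x t - x s)\<^sup>2) \<partial>distr M (Pi\<^sub>M {0..} (\<lambda>_. borel)) (\<lambda>\<omega>. \<lambda>t\<in>{0..}. X t \<omega>))"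
      using F mem mX by (subst nn_integral_distr) (auto intro!: measurable_restrict)
    also have "\<dots> = (\<integral>\<^sup>+\<omega>. ennreal ((c * I t \<omega> - c * I s \<omega>)\<^sup>2) \<partial>N)"
      using F mem mI unfolding law[unfolded same_process_law_def]
      by (subst nn_integral_distr) (auto intro!: measurable_restrict borel_measurable_times simp: c_def)
    also have "\<dots> = (\<integral>\<^sup>+\<omega>. ennreal (c\<^sup>2) * ennreal ((I t \<omega> - I s \<omega>)\<^sup>2) \<partial>N)"
      by (simp add: right_diff_distrib[symmetric] power_mult_distrib ennreal_mult')
    also have "\<dots> = ennreal (c\<^sup>2) * (\<integral>\<^sup>+\<omega>. ennreal ((I t \<omega> - I s \<omega>)\<^sup>2) \<partial>N)"
      by (rule nn_integral_cmult) measurable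
    also have "\<dots> \<le> ennreal (c\<^sup>2) * (9 * (\<integral>\<^sup>+u. ennreal ((gfbm_kernel \<alpha> \<gamma> t u - gfbm_kernel \<alpha> \<gamma> s u)\<^sup>2) \<partial>lborel))"
      using st by (intro mult_left_mono wiener_integral_diff_bound[OF B] I) auto
    also have "\<dots> \<le> ennreal (c\<^sup>2) * (9 * ennreal (C * (t - s) powr (2 * \<alpha> - \<gamma> + 1)))"
      using st by (intro mult_left_mono C(2)) auto
    also have "\<dots> = ennreal (9 * c\<^sup>2 * C * (t - s) powr (2 * \<alpha> - \<gamma> + 1))"
      using C(1) by (simp add: ennreal_mult' mult_ac ennreal_mult'[of 9, simplified])
    finally have le: "(\<integral>\<^sup>+\<omega>. ennreal ((X t \<omega> - X s \<omega>)\<^sup>2) \<partial>M)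
        \<le> ennreal (9 * c\<^sup>2 * C * (t - s) powr (2 * \<alpha> - \<gamma> + 1))" .
    have "incr_second_moment M X s t = enn2real (\<integral>\<^sup>+\<omega>. ennreal ((X t \<omega> - X s \<omega>)\<^sup>2) \<partial>M)"
      unfolding incr_second_moment_def by (subst integral_eq_nn_integral) (auto simp: power2_commute)
    also have "\<dots> \<le> 9 * c\<^sup>2 * C * (t - s) powr (2 * \<alpha> - \<gamma> + 1)"
      using C(1) le by (intro enn2real_leI) auto
    also have "\<dots> \<le> (9 * c\<^sup>2 * C + 1) * (t - s) powr (2 * \<alpha> - \<gamma> + 1)"
      by (intro mult_right_mono) auto
    finally show ?thesis .
  qed
  then show ?thesis using C(1) by (intro that[of "9 * c\<^sup>2 * C + 1"]) (auto intro: add_nonneg_pos)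
qed

theorem theorem3p1:
  fixes \<alpha> \<gamma> H :: real
    and N :: "'b measure" and B :: "real set \<Rightarrow> 'b \<Rightarrow> real"
    and M :: "'a measure" and X :: "real \<Rightarrow> 'a \<Rightarrow> real"
  assumes "0 \<le> \<gamma>" and "\<gamma> < 1"
    and "- 1/2 + \<gamma>/2 < \<alpha>" and "\<alpha> < 1/2 + \<gamma>/2"
    and "H = \<alpha> - \<gamma>/2 + 1/2"
    and "gaussian_random_measure N lborel B"
    and "is_gfbm \<alpha> \<gamma> N B M X"
  shows "\<forall>T>0.
    (\<exists>C>0. \<forall>s t. 0 < s \<and> s < t \<and> t \<le> T \<longrightarrow>
        incr_second_moment M X s t \<le> C * \<bar>s - t\<bar> powr (2 * H)) \<and>
    (\<forall>\<alpha>\<^sub>0. 0 < \<alpha>\<^sub>0 \<and> \<alpha>\<^sub>0 < H \<longrightarrow>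
        (AE \<omega> in M. holder_on \<alpha>\<^sub>0 {0..T} (\<lambda>t. X t \<omega>)))"
proof -
  have H: "2 * \<alpha> - \<gamma> + 1 = 2 * H" using assms(5) by (simp add: field_simps)
  obtain C :: real where C: "0 < C"
    "\<And>s t. 0 \<le> s \<Longrightarrow> s < t \<Longrightarrow> incr_second_moment M X s t \<le> C * (t - s) powr (2 * H)"
    using gfbm_incr_second_moment_bound[OF assms(1-4,6,7)] unfolding H by blast
  have X: "prob_space M" "centered_gaussian_process M {0..} X"
    "AE \<omega> in M. continuous_on {0..} (\<lambda>t. X t \<omega>)"
    using assms(7) by (auto simp: is_gfbm_def)
  show ?thesis
  proof (intro allI impI conjI)
    show "\<exists>C>0. \<forall>s t. 0 < s \<and> s < t \<and> t \<le> T \<longrightarrow>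
        incr_second_moment M X s t \<le> C * \<bar>s - t\<bar> powr (2 * H)" for T
      \<comment> \<open>The witness is the constant obtained on the whole half-line.\<close>
      using C by (intro exI[of _ C]) (auto simp: abs_minus_commute)
  next
    fix T \<alpha>\<^sub>0 :: real assume "0 < T" "0 < \<alpha>\<^sub>0 \<and> \<alpha>\<^sub>0 < H"
    then show "AE \<omega> in M. holder_on \<alpha>\<^sub>0 {0..T} (\<lambda>t. X t \<omega>)"
      using gaussian_process_holder[OF X less_imp_le[OF C(1)], of H] C(2)
      by (auto simp: incr_second_moment_def power2_commute)
  qed
qed

end
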